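(* Let $\mathcal A$ be a well-founded $\Sigma$-algebra, $\succsim$ a quasi-precedence and $\sigma$ a partial status. If $\mathcal A$ is weakly monotone and weakly simple with respect to $\sigma$, then $(\succsim_{\mathrm{WPO}},\succ_{\mathrm{WPO}})$ (the refined WPO pair induced by $\mathcal A,\succsim,\sigma$) forms a reduction pair.
   Context: Terms over a finite signature $\Sigma$ and variables $\mathcal V$. Well-founded $\Sigma$-algebra $\mathcal A=(A,\geq,>,(f_{\mathcal A}))$: quasi-order $\geq$, well-founded strict order $>$ with ${\geq}\circ{>}\circ{\geq}\subseteq{>}$, $f_{\mathcal A}:A^n\to A$. On terms, $s\geq_{\mathcal A}t$ (resp. $>_{\mathcal A}$) iff $\hat\alpha(s)\geq\hat\alpha(t)$ (resp. $>$) for all $\alpha:\mathcal V\to A$. $\mathcal A$ is weakly monotone iff $a\geq b$ implies $f_{\mathcal A}(\dots,a,\dots)\geq f_{\mathcal A}(\dots,b,\dots)$. A partial status $\sigma$ assigns to each $f\in\Sigma_n$ a list of distinct positions in $\{1..n\}$ (also viewed as a set); $\sigma(f)(s_1..s_n)$ is the list of the $s_i$ at those positions in that order. $\mathcal A$ is weakly (strictly) simple w.r.t. $\sigma$ iff $f_{\mathcal A}(\dots,a_i,\dots)\geq a_i$ ($>a_i$) for every $f$ and $i\in\sigma(f)$. Quasi-precedence: quasi-order $\succsim$ on $\Sigma$ with well-founded strict part $\succ$, equivalence $\sim$. For a pair $(\succsim',\succ')$: $[s_1..s_n]\succsim'^{\mathrm{lex}}[t_1..t_m]$ iff there is $k\le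 n$ with $s_i\succsim' t_i$ for $i\le k$ and either $k=m$, or $k<\min(n,m)$ and $s_{k+1}\succ' t_{k+1}$; $\succ'^{\mathrm{lex}}$ likewise but in the case $k=m$ additionally $k<n$. Refined WPO pair: $\succsim_W,\succ_W$ defined simultaneously by recursion: $x\succsim_W x$ for variables; for $s=f(s_1..s_n)$, $s\succsim_W t$ (resp. $\succ_W$) iff (1) $s>_{\mathcal A}t$, or (2) $s\ge_{\mathcal A}t$ and (a) $s_i\succsim_W t$ for some $i\in\sigma(f)$, or (b) $t=g(t_1..t_m)$, $s\succ_W t_j$ for all $j\in\sigma(g)$, and $f\succ g$ or ($f\sim g$ and $\sigma(f)(\vec s)\succsim_W^{\mathrm{lex}}\sigma(g)(\vec t)$, resp. $\succ_W^{\mathrm{lex}}$). Additionally $s\succsim_W t$ holds if $s\ge_{\mathcal A}t$ and (2c) $s\in\mathcal V$, $t=g(t_1..t_m)$, $\sigma(g)=[\,]$ and $f\succsim g$ for all $f\in\Sigma$; or (2d) (included only when $\mathcal A$ is strictly simple w.r.t. $\sigma$) $s=f(s_1..s_n)$, $t\in\mathcal V$, and for every $g\in\Sigma$, $f\succ g$ or ($f\succsim g$ and $\sigma(g)=[\,]$). Nothing else is related. A reduction pair $(\succsim,\succ)$ on terms: $\succsim$ is a monotonic (i.e. $s\succsim t\Rightarrow f(\dots,s,\dots)\succsim f(\dots,t,\dots)$) and stable ($s\succsim t\Rightarrow s\theta\succsim t\theta$ for substitutions $\theta$) quasi-order, and $\succ$ is a well-founded stable strict order with ${\succsim}\circ{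\succ}\circ{\succsim}\subseteq{\succ}$.
   Formalization: Two hypotheses are added, without which the claim fails: > is contained in ≥ on A (else monotonicity can fail), and it is not the case that Σ is nonempty, ≥ is the full relation, all statuses are empty and all symbols are equivalent (else transitivity fails via (2c), (2d)). *)

theory Defs
  imports Main
begin

datatype ('f, 'v) trm = Var 'v | Fun 'f "('f, 'v) trm list"

text \<open>The signature is a set \<open>F\<close> of symbols with arities \<open>ar\<close>. The datatype contains
  ill-formed terms, so all properties of relations on terms are relativised to this set.\<close>

inductive_set terms :: "'f set \<Rightarrow> ('f \<Rightarrow> nat) \<Rightarrow> ('f, 'v) trm set"
  for F :: "'f set" and ar :: "'f \<Rightarrow> nat" where
  "Var x \<in> terms F ar"
| "f \<in> F \<Longrightarrow> length ts = ar f \<Longrightarrow> \<forall>t \<in> set ts. t \<in> terms F ar \<Longrightarrow> Fun f ts \<in> terms F ar"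

primrec subst :: "('v \<Rightarrow> ('f, 'v) trm) \<Rightarrow> ('f, 'v) trm \<Rightarrow> ('f, 'v) trm" where
  "subst \<theta> (Var x) = \<theta> x"
| "subst \<theta> (Fun f ts) = Fun f (map (subst \<theta>) ts)"

primrec eval :: "('f \<Rightarrow> 'a list \<Rightarrow> 'a) \<Rightarrow> ('v \<Rightarrow> 'a) \<Rightarrow> ('f, 'v) trm \<Rightarrow> 'a" where
  "eval I \<alpha> (Var x) = \<alpha> x"
| "eval I \<alpha> (Fun f ts) = I f (map (eval I \<alpha>) ts)"

subsection \<open>Orders\<close>

definition quasi_order_on :: "'a set \<Rightarrow> ('a \<Rightarrow> 'a \<Rightarrow> bool) \<Rightarrow> bool" where
  "quasi_order_on A R \<longleftrightarrow> reflp_on A R \<and> transp_on A R"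

definition strict_ord_on :: "'a set \<Rightarrow> ('a \<Rightarrow> 'a \<Rightarrow> bool) \<Rightarrow> bool" where
  "strict_ord_on A R \<longleftrightarrow> irreflp_on A R \<and> transp_on A R"

text \<open>Strict orders are written with the larger element on the left, hence the converse.\<close>

definition well_founded_on :: "'a set \<Rightarrow> ('a \<Rightarrow> 'a \<Rightarrow> bool) \<Rightarrow> bool" where
  "well_founded_on A R \<longleftrightarrow> wfp_on A (R\<inverse>\<inverse>)"

definition compatible_on :: "'a set \<Rightarrow> ('a \<Rightarrow> 'a \<Rightarrow> bool) \<Rightarrow> ('a \<Rightarrow> 'a \<Rightarrow> bool) \<Rightarrow> bool" where
  "compatible_on A R S \<longleftrightarrow>
     (\<forall>a\<in>A. \<forall>b\<in>A. \<forall>c\<in>A. \<forall>d\<in>A. R a b \<longrightarrow> S b c \<longrightarrow> R c d \<longrightarrow> S a d)"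

definition wf_order_pair_on :: "'a set \<Rightarrow> ('a \<Rightarrow> 'a \<Rightarrow> bool) \<Rightarrow> ('a \<Rightarrow> 'a \<Rightarrow> bool) \<Rightarrow> bool" where
  "wf_order_pair_on A R S \<longleftrightarrow>
     quasi_order_on A R \<and> strict_ord_on A S \<and> well_founded_on A S \<and> compatible_on A R S"

definition strict_part :: "('a \<Rightarrow> 'a \<Rightarrow> bool) \<Rightarrow> 'a \<Rightarrow> 'a \<Rightarrow> bool" where
  "strict_part R a b \<longleftrightarrow> R a b \<and> \<not> R b a"

definition equiv_part :: "('a \<Rightarrow> 'a \<Rightarrow> bool) \<Rightarrow> 'a \<Rightarrow> 'a \<Rightarrow> bool" where
  "equiv_part R a b \<longleftrightarrow> R a b \<and> R b a"

definition quasi_precedence :: "'f set \<Rightarrow> ('f \<Rightarrow> 'f \<Rightarrow> bool) \<Rightarrow> bool" where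
  "quasi_precedence F prec \<longleftrightarrow> quasi_order_on F prec \<and> well_founded_on F (strict_part prec)"

definition lex_ns ::
  "('a \<Rightarrow> 'a \<Rightarrow> bool) \<Rightarrow> ('a \<Rightarrow> 'a \<Rightarrow> bool) \<Rightarrow> 'a list \<Rightarrow> 'a list \<Rightarrow> bool" where
  "lex_ns R S ss ts \<longleftrightarrow>
     (\<exists>k \<le> length ss. (\<forall>i<k. R (ss ! i) (ts ! i)) \<and>
        (k = length ts \<or> k < min (length ss) (length ts) \<and> S (ss ! k) (ts ! k)))"

definition lex_s ::
  "('a \<Rightarrow> 'a \<Rightarrow> bool) \<Rightarrow> ('a \<Rightarrow> 'a \<Rightarrow> bool) \<Rightarrow> 'a list \<Rightarrow> 'a list \<Rightarrow> bool" where
  "lex_s R S ss ts \<longleftrightarrow>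
     (\<exists>k \<le> length ss. (\<forall>i<k. R (ss ! i) (ts ! i)) \<and>
        (k = length ts \<and> k < length ss \<or>
         k < min (length ss) (length ts) \<and> S (ss ! k) (ts ! k)))"

lemma lex_ns_mono [mono]:
  assumes "\<And>a b. R a b \<longrightarrow> R' a b" and "\<And>a b. S a b \<longrightarrow> S' a b"
  shows "lex_ns R S ss ts \<longrightarrow> lex_ns R' S' ss ts"
  using assms unfolding lex_ns_def by blast

lemma lex_s_mono [mono]:
  assumes "\<And>a b. R a b \<longrightarrow> R' a b" and "\<And>a b. S a b \<longrightarrow> S' a b"
  shows "lex_s R S ss ts \<longrightarrow> lex_s R' S' ss ts"
  using assms unfolding lex_s_def by blast

subsection \<open>Algebras and partial statuses\<close>

text \<open>The carrier of the algebra is a type, hence nonempty; \<open>I f\<close> is only ever constrained on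
  argument lists of length \<open>ar f\<close>.\<close>

definition well_founded_algebra :: "('a \<Rightarrow> 'a \<Rightarrow> bool) \<Rightarrow> ('a \<Rightarrow> 'a \<Rightarrow> bool) \<Rightarrow> bool" where
  "well_founded_algebra ge gt \<longleftrightarrow> wf_order_pair_on UNIV ge gt"

definition alg_rel ::
  "('f \<Rightarrow> 'a list \<Rightarrow> 'a) \<Rightarrow> ('a \<Rightarrow> 'a \<Rightarrow> bool) \<Rightarrow> ('f, 'v) trm \<Rightarrow> ('f, 'v) trm \<Rightarrow> bool" where
  "alg_rel I R s t \<longleftrightarrow> (\<forall>\<alpha>. R (eval I \<alpha> s) (eval I \<alpha> t))"

definition weakly_monotone ::
  "'f set \<Rightarrow> ('f \<Rightarrow> nat) \<Rightarrow> ('f \<Rightarrow> 'a list \<Rightarrow> 'a) \<Rightarrow> ('a \<Rightarrow> 'a \<Rightarrow> bool) \<Rightarrow> bool" where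
  "weakly_monotone F ar I ge \<longleftrightarrow>
     (\<forall>f\<in>F. \<forall>as i b. length as = ar f \<longrightarrow> i < ar f \<longrightarrow> ge (as ! i) b \<longrightarrow>
        ge (I f as) (I f (as[i := b])))"

text \<open>Argument positions are counted from \<open>0\<close>, as for list indexing.\<close>

definition partial_status :: "'f set \<Rightarrow> ('f \<Rightarrow> nat) \<Rightarrow> ('f \<Rightarrow> nat list) \<Rightarrow> bool" where
  "partial_status F ar \<sigma> \<longleftrightarrow> (\<forall>f\<in>F. distinct (\<sigma> f) \<and> set (\<sigma> f) \<subseteq> {..<ar f})"

text \<open>Weak simplicity is the instance \<open>R = (\<ge>)\<close>, strict simplicity the instance \<open>R = (>)\<close>.\<close>

definition simple_wrt ::
  "'f set \<Rightarrow> ('f \<Rightarrow> nat) \<Rightarrow> ('f \<Rightarrow> 'a list \<Rightarrow> 'a) \<Rightarrow> ('f \<Rightarrow> nat list) \<Rightarrow> ('a \<Rightarrow> 'a \<Rightarrow> bool) \<Rightarrow> bool"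
  where
  "simple_wrt F ar I \<sigma> R \<longleftrightarrow>
     (\<forall>f\<in>F. \<forall>as. length as = ar f \<longrightarrow> (\<forall>i \<in> set (\<sigma> f). R (I f as) (as ! i)))"

subsection \<open>The refined weighted path order\<close>

text \<open>On well-formed terms every premise about \<open>wpo_ns\<close> or \<open>wpo_s\<close> concerns a strictly smaller pair
  of terms, so the least fixed point is the relation pair defined by recursion.\<close>

inductive
  wpo_ns :: "'f set \<Rightarrow> ('f \<Rightarrow> nat) \<Rightarrow> ('f \<Rightarrow> 'a list \<Rightarrow> 'a) \<Rightarrow> ('a \<Rightarrow> 'a \<Rightarrow> bool) \<Rightarrow>
    ('a \<Rightarrow> 'a \<Rightarrow> bool) \<Rightarrow> ('f \<Rightarrow> 'f \<Rightarrow> bool) \<Rightarrow> ('f \<Rightarrow> nat list) \<Rightarrow>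
    ('f, 'v) trm \<Rightarrow> ('f, 'v) trm \<Rightarrow> bool" and
  wpo_s :: "'f set \<Rightarrow> ('f \<Rightarrow> nat) \<Rightarrow> ('f \<Rightarrow> 'a list \<Rightarrow> 'a) \<Rightarrow> ('a \<Rightarrow> 'a \<Rightarrow> bool) \<Rightarrow>
    ('a \<Rightarrow> 'a \<Rightarrow> bool) \<Rightarrow> ('f \<Rightarrow> 'f \<Rightarrow> bool) \<Rightarrow> ('f \<Rightarrow> nat list) \<Rightarrow>
    ('f, 'v) trm \<Rightarrow> ('f, 'v) trm \<Rightarrow> bool"
  for F :: "'f set" and ar :: "'f \<Rightarrow> nat" and I :: "'f \<Rightarrow> 'a list \<Rightarrow> 'a"
    and ge :: "'a \<Rightarrow> 'a \<Rightarrow> bool" and gt :: "'a \<Rightarrow> 'a \<Rightarrow> bool"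
    and prec :: "'f \<Rightarrow> 'f \<Rightarrow> bool" and \<sigma> :: "'f \<Rightarrow> nat list"
where
  ns_var: "wpo_ns F ar I ge gt prec \<sigma> (Var x) (Var x)"
| ns_1: "alg_rel I gt (Fun f ss) t \<Longrightarrow> wpo_ns F ar I ge gt prec \<sigma> (Fun f ss) t"
| ns_2a: "alg_rel I ge (Fun f ss) t \<Longrightarrow> i \<in> set (\<sigma> f) \<Longrightarrow>
    wpo_ns F ar I ge gt prec \<sigma> (ss ! i) t \<Longrightarrow> wpo_ns F ar I ge gt prec \<sigma> (Fun f ss) t"
| ns_2b: "alg_rel I ge (Fun f ss) (Fun g ts) \<Longrightarrow>
    \<forall>j \<in> set (\<sigma> g). wpo_s F ar I ge gt prec \<sigma> (Fun f ss) (ts ! j) \<Longrightarrow>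
    strict_part prec f g \<or> equiv_part prec f g \<and>
      lex_ns (wpo_ns F ar I ge gt prec \<sigma>) (wpo_s F ar I ge gt prec \<sigma>)
        (map ((!) ss) (\<sigma> f)) (map ((!) ts) (\<sigma> g)) \<Longrightarrow>
    wpo_ns F ar I ge gt prec \<sigma> (Fun f ss) (Fun g ts)"
| ns_2c: "alg_rel I ge (Var x) (Fun g ts) \<Longrightarrow> \<sigma> g = [] \<Longrightarrow> \<forall>f\<in>F. prec f g \<Longrightarrow>
    wpo_ns F ar I ge gt prec \<sigma> (Var x) (Fun g ts)"
| ns_2d: "simple_wrt F ar I \<sigma> gt \<Longrightarrow> alg_rel I ge (Fun f ss) (Var y) \<Longrightarrow>
    \<forall>g\<in>F. strict_part prec f g \<or> prec f g \<and> \<sigma> g = [] \<Longrightarrow>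
    wpo_ns F ar I ge gt prec \<sigma> (Fun f ss) (Var y)"
| s_1: "alg_rel I gt (Fun f ss) t \<Longrightarrow> wpo_s F ar I ge gt prec \<sigma> (Fun f ss) t"
| s_2a: "alg_rel I ge (Fun f ss) t \<Longrightarrow> i \<in> set (\<sigma> f) \<Longrightarrow>
    wpo_ns F ar I ge gt prec \<sigma> (ss ! i) t \<Longrightarrow> wpo_s F ar I ge gt prec \<sigma> (Fun f ss) t"
| s_2b: "alg_rel I ge (Fun f ss) (Fun g ts) \<Longrightarrow>
    \<forall>j \<in> set (\<sigma> g). wpo_s F ar I ge gt prec \<sigma> (Fun f ss) (ts ! j) \<Longrightarrow>
    strict_part prec f g \<or> equiv_part prec f g \<and>
      lex_s (wpo_ns F ar I ge gt prec \<sigma>) (wpo_s F ar I ge gt prec \<sigma>)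
        (map ((!) ss) (\<sigma> f)) (map ((!) ts) (\<sigma> g)) \<Longrightarrow>
    wpo_s F ar I ge gt prec \<sigma> (Fun f ss) (Fun g ts)"

subsection \<open>Reduction pairs\<close>

definition monotonic ::
  "'f set \<Rightarrow> ('f \<Rightarrow> nat) \<Rightarrow> (('f, 'v) trm \<Rightarrow> ('f, 'v) trm \<Rightarrow> bool) \<Rightarrow> bool" where
  "monotonic F ar R \<longleftrightarrow>
     (\<forall>f\<in>F. \<forall>ss i t. length ss = ar f \<longrightarrow> set ss \<subseteq> terms F ar \<longrightarrow> i < ar f \<longrightarrow>
        t \<in> terms F ar \<longrightarrow> R (ss ! i) t \<longrightarrow> R (Fun f ss) (Fun f (ss[i := t])))"

definition stable ::
  "'f set \<Rightarrow> ('f \<Rightarrow> nat) \<Rightarrow> (('f, 'v) trm \<Rightarrow> ('f, 'v) trm \<Rightarrow> bool) \<Rightarrow> bool" where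
  "stable F ar R \<longleftrightarrow>
     (\<forall>s \<in> terms F ar. \<forall>t \<in> terms F ar. \<forall>\<theta>. range \<theta> \<subseteq> terms F ar \<longrightarrow>
        R s t \<longrightarrow> R (subst \<theta> s) (subst \<theta> t))"

definition trm_reduction_pair ::
  "'f set \<Rightarrow> ('f \<Rightarrow> nat) \<Rightarrow> (('f, 'v) trm \<Rightarrow> ('f, 'v) trm \<Rightarrow> bool) \<Rightarrow>
    (('f, 'v) trm \<Rightarrow> ('f, 'v) trm \<Rightarrow> bool) \<Rightarrow> bool" where
  "trm_reduction_pair F ar R S \<longleftrightarrow>
     wf_order_pair_on (terms F ar) R S \<and> monotonic F ar R \<and> stable F ar R \<and> stable F ar S"

text \<open>Two side conditions do not follow from the definitions above, and the pair
  \<open>(wpo_ns, wpo_s)\<close> need not be a reduction pair without them.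
  (i) \<open>gt \<subseteq> ge\<close>: \<open>well_founded_algebra\<close> does not include it, and if it fails, \<open>s >\<^sub>A t\<close> relates
  \<open>s\<close> and \<open>t\<close> by \<open>ns_1\<close> while weak monotonicity says nothing about \<open>f(\<dots>s\<dots>)\<close> and
  \<open>f(\<dots>t\<dots>)\<close>.
  (ii) If \<open>ge\<close> is the full relation, every status is empty and all symbols are equivalent, then the
  algebra is vacuously strictly simple, and \<open>ns_2c\<close> and \<open>ns_2d\<close> give \<open>x \<succeq> c \<succeq> y\<close> for distinct
  variables \<open>x\<close> and \<open>y\<close>, which are themselves unrelated.\<close>

end

theory Submission
  imports Defs
begin

text \<open>Transitivity and compatibility are proved together by induction on the total size of the three
  terms, for the relation \<open>wpo\<close> whose Boolean argument selects the strict or the non-strict part.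
  Two composites need more than the usual path-order argument: \<open>x \<ge>\<^sub>A g(\<dots>) >\<^sub>A u\<close> is excluded because
  evaluating \<open>u\<close> under constant assignments would give an infinite descent in \<open>A\<close>, and
  \<open>x \<succeq> g(\<dots>) \<succeq> y\<close> for distinct variables forces the degenerate situation excluded by hypothesis.
  For well-foundedness, \<open>f(s\<^sub>1..s\<^sub>n)\<close> is accessible as soon as its arguments at positions in
  \<open>\<sigma>(f)\<close> are, by lexicographic induction on its value in \<open>A\<close>, its root, and these arguments; finiteness
  of the signature bounds the length of the argument lists.\<close>

section \<open>Lexicographic extensions\<close>

text \<open>Indexing the strict and the non-strict relation by a Boolean lets a single composition
  law with index \<open>b \<or> c\<close> cover all four combinations of the two.\<close>

definition lex_ext :: "bool \<Rightarrow> (bool \<Rightarrow> 'a \<Rightarrow> 'a \<Rightarrow> bool) \<Rightarrow> 'a list \<Rightarrow> 'a list \<Rightarrow> bool" where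
  "lex_ext b W = (if b then lex_s (W False) (W True) else lex_ns (W False) (W True))"

lemma lex_ext_Nil [simp]: "lex_ext b W [] ys \<longleftrightarrow> \<not> b \<and> ys = []"
  by (auto simp: lex_ext_def lex_s_def lex_ns_def)

lemma lex_ext_Cons_Nil [simp]: "lex_ext b W (x # xs) []"
  by (auto simp: lex_ext_def lex_s_def lex_ns_def)

text \<open>The prefix length \<open>k\<close> is either 0, so that \<open>S\<close> decides at the
  heads, or a successor, so that the heads are related by \<open>R\<close> and deleting them lowers
  \<open>k\<close> by one.\<close>

lemma lex_ns_Cons_Cons:
  "lex_ns R S (x # xs) (y # ys) \<longleftrightarrow> S x y \<or> R x y \<and> lex_ns R S xs ys" (is "?L \<longleftrightarrow> ?R")
proof
  assume ?L
  then obtain k where k: "k \<le> length (x # xs)" "\<forall>i<k. R ((x # xs) ! i) ((y # ys) ! i)"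
    "k = length (y # ys) \<or> k < min (length (x # xs)) (length (y # ys)) \<and> S ((x # xs) ! k) ((y # ys) ! k)"
    unfolding lex_ns_def by blast
  show ?R
  proof (cases k)
    case (Suc k')
    have "R x y" using k(2) Suc by auto
    moreover have "\<forall>i<k'. R (xs ! i) (ys ! i)" using k(2) Suc by fastforce
    ultimately show ?thesis using k(1,3) Suc unfolding lex_ns_def by auto
  qed (use k in auto)
next
  assume ?R
  then show ?L
  proof
    assume "S x y"
    then show ?L unfolding lex_ns_def by (intro exI[of _ 0]) auto
  next
    assume "R x y \<and> lex_ns R S xs ys"
    then obtain k where k: "R x y" "k \<le> length xs" "\<forall>i<k. R (xs ! i) (ys ! i)"
      "k = length ys \<or> k < min (length xs) (length ys) \<and> S (xs ! k) (ys ! k)"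
      unfolding lex_ns_def by blast
    then show ?L unfolding lex_ns_def by (intro exI[of _ "Suc k"]) (auto simp: less_Suc_eq_0_disj)
  qed
qed

lemma lex_s_Cons_Cons:
  "lex_s R S (x # xs) (y # ys) \<longleftrightarrow> S x y \<or> R x y \<and> lex_s R S xs ys" (is "?L \<longleftrightarrow> ?R")
proof
  assume ?L
  then obtain k where k: "k \<le> length (x # xs)" "\<forall>i<k. R ((x # xs) ! i) ((y # ys) ! i)"
    "k = length (y # ys) \<and> k < length (x # xs) \<or>
     k < min (length (x # xs)) (length (y # ys)) \<and> S ((x # xs) ! k) ((y # ys) ! k)"
    unfolding lex_s_def by blast
  show ?R
  proof (cases k)
    case (Suc k')
    have "R x y" using k(2) Suc by auto
    moreover have "\<forall>i<k'. R (xs ! i) (ys ! i)" using k(2) Suc by fastforce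
    ultimately show ?thesis using k(1,3) Suc unfolding lex_s_def by auto
  qed (use k in auto)
next
  assume ?R
  then show ?L
  proof
    assume "S x y"
    then show ?L unfolding lex_s_def by (intro exI[of _ 0]) auto
  next
    assume "R x y \<and> lex_s R S xs ys"
    then obtain k where k: "R x y" "k \<le> length xs" "\<forall>i<k. R (xs ! i) (ys ! i)"
      "k = length ys \<and> k < length xs \<or> k < min (length xs) (length ys) \<and> S (xs ! k) (ys ! k)"
      unfolding lex_s_def by blast
    then show ?L unfolding lex_s_def by (intro exI[of _ "Suc k"]) (auto simp: less_Suc_eq_0_disj)
  qed
qed

lemma lex_ext_Cons_Cons [simp]:
  "lex_ext b W (x # xs) (y # ys) \<longleftrightarrow> W True x y \<or> W False x y \<and> lex_ext b W xs ys"
  by (auto simp: lex_ext_def lex_ns_Cons_Cons lex_s_Cons_Cons)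

lemma lex_ext_strict_imp: "lex_ext True W xs ys \<Longrightarrow> lex_ext b W xs ys"
  by (induction xs ys rule: list_induct2') auto

lemma lex_ext_Nil_right: "lex_ext False W xs []"
  by (cases xs) auto

text \<open>Composition is assumed only for members of the three lists, so that an induction
  hypothesis about smaller terms can discharge it.\<close>

lemma lex_ext_trans:
  assumes "\<And>x y z b c. x \<in> set xs \<Longrightarrow> y \<in> set ys \<Longrightarrow> z \<in> set zs \<Longrightarrow> W b x y \<Longrightarrow> W c y z \<Longrightarrow>
      W (b \<or> c) x z"
    and "lex_ext b W xs ys" "lex_ext c W ys zs"
  shows "lex_ext (b \<or> c) W xs zs"
  using assms
proof (induction xs arbitrary: ys zs)
  case (Cons x xs)
  show ?case
  proof (cases zs)
    case (Cons z zs')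
    with Cons.prems(3) obtain y ys' where ys: "ys = y # ys'" by (cases ys) auto
    have step: "\<And>b c. W b x y \<Longrightarrow> W c y z \<Longrightarrow> W (b \<or> c) x z"
      by (rule Cons.prems(1)) (simp_all add: ys Cons)
    have rec: "lex_ext (b \<or> c) W xs zs'" if "lex_ext b W xs ys'" "lex_ext c W ys' zs'"
      by (rule Cons.IH[OF Cons.prems(1) that]) (simp_all add: ys Cons)
    show ?thesis
      using Cons.prems(2,3) step[of True True] step[of True False] step[of False True]
        step[of False False] rec unfolding ys Cons lex_ext_Cons_Cons by (simp only: simp_thms) blast
  qed simp
qed auto

lemma lex_ext_map:
  assumes "lex_ext b W xs ys"
    and "\<And>c x y. x \<in> set xs \<Longrightarrow> y \<in> set ys \<Longrightarrow> W c x y \<Longrightarrow> W c (h x) (h y)"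
  shows "lex_ext b W (map h xs) (map h ys)"
  using assms by (induction xs ys rule: list_induct2') auto

lemma lex_ext_pointwise:
  assumes "length xs = length ys" "\<And>i. i < length xs \<Longrightarrow> W False (xs ! i) (ys ! i)"
  shows "lex_ext False W xs ys"
  using assms unfolding lex_ext_def lex_ns_def by auto

text \<open>The length bound is essential: for \<open>b\<close> strictly above \<open>a\<close>, the
  lists \<open>[b]\<close>, \<open>[a, b]\<close>, \<open>[a, a, b]\<close>, ... descend forever.
  Induction on the bound treats the tails; for a longer list, well-founded induction on the head
  encloses the induction on the tail.\<close>

lemma wfp_on_lex_ext:
  assumes wf: "wfp_on A (\<lambda>x y. W True y x)"
    and refl: "\<And>x. x \<in> A \<Longrightarrow> W False x x"
    and trans: "\<And>b c x y z. x \<in> A \<Longrightarrow> y \<in> A \<Longrightarrow> z \<in> A \<Longrightarrow> W b x y \<Longrightarrow> W c y z \<Longrightarrow> W (b \<or> c) x z"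
  shows "wfp_on {xs. set xs \<subseteq> A \<and> length xs \<le> N} (\<lambda>xs ys. lex_ext True W ys xs)"
proof (induction N)
  case 0
  show ?case by (subst wfp_on_iff_wfp, rule accp_wfpI, rule allI, rule accpI) auto
next
  case (Suc N)
  let ?L = "\<lambda>n. {xs. set xs \<subseteq> A \<and> length xs \<le> n}"
  \<comment> \<open>Lists outside the bounded set have no \<open>r\<close>-predecessors, so
    accessibility on the whole type amounts to well-foundedness on that set.\<close>
  define r where "r = (\<lambda>xs ys. lex_ext True W ys xs \<and> xs \<in> ?L (Suc N) \<and> ys \<in> ?L (Suc N))"
  have nil: "Wellfounded.accp r []"
    by (rule accpI) (simp add: r_def)
  \<comment> \<open>A step that is strict only in the tail may still replace the head by one weakly
    below it, so the claim covers every head \<open>y\<close> weakly below \<open>x\<close>.\<close>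
  have cons: "\<forall>y ys. y \<in> A \<longrightarrow> W False x y \<longrightarrow> ys \<in> ?L N \<longrightarrow> Wellfounded.accp r (y # ys)"
    if "x \<in> A" for x
    using wf
  proof (induction x rule: wfp_on_induct)
    case in_set
    show ?case by (fact that)
  next
    case (less x)
    have "\<forall>y. y \<in> A \<longrightarrow> W False x y \<longrightarrow> Wellfounded.accp r (y # ys)" if "ys \<in> ?L N" for ys
      using Suc.IH
    proof (induction ys rule: wfp_on_induct)
      case in_set
      show ?case by (fact that)
    next
      case inner: (less ys)
      show ?case
      proof (intro allI impI, rule accpI)
        fix y zs assume y: "y \<in> A" "W False x y" and zs: "r zs (y # ys)"
        show "Wellfounded.accp r zs"
        proof (cases zs)
          case Nil
          then show ?thesis using nil by simp
        next
          case (Cons z zs')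
          have z: "z \<in> A" "zs' \<in> ?L N" using zs Cons unfolding r_def by auto
          consider "W True y z" | "W False y z" "lex_ext True W ys zs'"
            using zs Cons unfolding r_def by auto
          then show ?thesis
          proof cases
            case 1
            then have "W True x z" using trans[of x y z False True] less.hyps y z by simp
            then show ?thesis using less.IH[of z] refl z Cons by blast
          next
            case 2
            then have "W False x z" using trans[of x y z False False] less.hyps y z by simp
            then show ?thesis using inner.IH[of zs'] 2 z Cons by blast
          qed
        qed
      qed
    qed
    then show ?case by blast
  qed
  have "Wellfounded.accp r xs" for xs
  proof (cases "xs \<in> ?L (Suc N)")
    case True
    then show ?thesis using nil cons refl by (cases xs) auto
  next
    case False
    then show ?thesis by - (rule accpI, simp add: r_def)
  qed
  then have "wfp r" by (simp add: wfp_iff_accp)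
  then show ?case unfolding r_def by (subst wfp_on_iff_wfp)
qed

section \<open>The refined weighted path order\<close>

lemma eval_subst: "eval I \<alpha> (subst \<theta> t) = eval I (\<lambda>x. eval I \<alpha> (\<theta> x)) t"
  by (induction t) (auto cong: map_cong)

lemma alg_rel_subst: "alg_rel I R s t \<Longrightarrow> alg_rel I R (subst \<theta> s) (subst \<theta> t)"
  by (simp add: alg_rel_def eval_subst)

lemma Fun_terms_iff:
  "Fun f ts \<in> terms F ar \<longleftrightarrow> f \<in> F \<and> length ts = ar f \<and> set ts \<subseteq> terms F ar"
  by (subst terms.simps) auto

section \<open>Setting: orders on the carrier, on the symbols and on terms by evaluation\<close>

locale wpo_setting =
  fixes F :: "'f set" and ar :: "'f \<Rightarrow> nat" and I :: "'f \<Rightarrow> 'a list \<Rightarrow> 'a"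
    and ge gt :: "'a \<Rightarrow> 'a \<Rightarrow> bool" and prec :: "'f \<Rightarrow> 'f \<Rightarrow> bool" and \<sigma> :: "'f \<Rightarrow> nat list"
  assumes finite_F: "finite F"
    and algebra: "well_founded_algebra ge gt"
    and gt_imp_ge: "gt a b \<Longrightarrow> ge a b"
    and precedence: "quasi_precedence F prec"
    and status: "partial_status F ar \<sigma>"
    and nondegenerate:
      "\<not> (F \<noteq> {} \<and> (\<forall>a b. ge a b) \<and> (\<forall>f\<in>F. \<sigma> f = []) \<and> (\<forall>f\<in>F. \<forall>g\<in>F. prec f g))"
    and monotone: "weakly_monotone F ar I ge"
    and simple: "simple_wrt F ar I \<sigma> ge"
begin

lemma ge_refl: "ge a a"
  using algebra
  by (simp add: well_founded_algebra_def wf_order_pair_on_def quasi_order_on_def reflp_on_def)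

lemma ge_trans: "ge a b \<Longrightarrow> ge b c \<Longrightarrow> ge a c"
  using algebra
  by (auto simp: well_founded_algebra_def wf_order_pair_on_def quasi_order_on_def
      intro: transp_onD)

lemma gt_compat: "ge a b \<Longrightarrow> gt b c \<Longrightarrow> ge c d \<Longrightarrow> gt a d"
  using algebra
  by (auto simp: well_founded_algebra_def wf_order_pair_on_def compatible_on_def)

lemma gt_wfp: "wfp (\<lambda>b a. gt a b)"
  using algebra
  by (simp add: well_founded_algebra_def wf_order_pair_on_def well_founded_on_def conversep_iff[abs_def])

lemma prec_refl: "f \<in> F \<Longrightarrow> prec f f"
  using precedence by (simp add: quasi_precedence_def quasi_order_on_def reflp_on_def)

lemma prec_trans: "f \<in> F \<Longrightarrow> g \<in> F \<Longrightarrow> h \<in> F \<Longrightarrow> prec f g \<Longrightarrow> prec g h \<Longrightarrow> prec f h"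
  using precedence by (auto simp: quasi_precedence_def quasi_order_on_def intro: transp_onD)

lemma prec_wfp: "wfp_on F (\<lambda>g f. strict_part prec f g)"
  using precedence
  by (simp add: quasi_precedence_def well_founded_on_def conversep_iff[abs_def])

lemma status_less: "f \<in> F \<Longrightarrow> i \<in> set (\<sigma> f) \<Longrightarrow> i < ar f"
  using status by (auto simp: partial_status_def)

lemma status_nth:
  assumes "Fun f ss \<in> terms F ar" "i \<in> set (\<sigma> f)"
  shows "ss ! i \<in> set ss" "ss ! i \<in> terms F ar"
  using assms status_less[of f i] by (auto simp: Fun_terms_iff)

definition args :: "'f \<Rightarrow> 'b list \<Rightarrow> 'b list" where
  "args f ss = map ((!) ss) (\<sigma> f)"

lemma args_subset: "Fun f ss \<in> terms F ar \<Longrightarrow> set (args f ss) \<subseteq> set ss"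
  using status_nth by (fastforce simp: args_def)

abbreviation alg_ge :: "('f, 'v) trm \<Rightarrow> ('f, 'v) trm \<Rightarrow> bool" where
  "alg_ge \<equiv> alg_rel I ge"

abbreviation alg_gt :: "('f, 'v) trm \<Rightarrow> ('f, 'v) trm \<Rightarrow> bool" where
  "alg_gt \<equiv> alg_rel I gt"

lemma alg_ge_refl: "alg_ge s s"
  by (simp add: alg_rel_def ge_refl)

lemma alg_ge_trans: "alg_ge s t \<Longrightarrow> alg_ge t u \<Longrightarrow> alg_ge s u"
  unfolding alg_rel_def using ge_trans by blast

lemma alg_gt_imp_ge: "alg_gt s t \<Longrightarrow> alg_ge s t"
  unfolding alg_rel_def using gt_imp_ge by blast

lemma alg_gt_ge_trans: "alg_gt s t \<Longrightarrow> alg_ge t u \<Longrightarrow> alg_gt s u"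
  unfolding alg_rel_def using gt_compat ge_refl by blast

lemma alg_ge_gt_trans: "alg_ge s t \<Longrightarrow> alg_gt t u \<Longrightarrow> alg_gt s u"
  unfolding alg_rel_def using gt_compat ge_refl by blast

text \<open>Kept generic in \<open>R\<close>: the instance \<open>ge\<close> yields the subterm
  property, and the instance \<open>gt\<close> is what strict simplicity contributes to the
  stability of clause \<open>ns_2d\<close>.\<close>

lemma alg_rel_arg:
  assumes "simple_wrt F ar I \<sigma> R" "Fun f ss \<in> terms F ar" "i \<in> set (\<sigma> f)"
  shows "alg_rel I R (Fun f ss) (ss ! i)"
proof -
  have "R (I f (map (eval I \<alpha>) ss)) (map (eval I \<alpha>) ss ! i)" for \<alpha> :: "'b \<Rightarrow> 'a"
    using assms by (auto simp: simple_wrt_def Fun_terms_iff)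
  then show ?thesis
    using assms status_less[of f i] by (simp add: alg_rel_def Fun_terms_iff)
qed

text \<open>Otherwise \<open>a > h a > h (h a) > \<dots>\<close> where \<open>h a\<close> is the value of \<open>u\<close> when every variable is
  assigned \<open>a\<close>.\<close>

lemma not_Var_alg_gt: "\<not> alg_gt (Var x) u"
proof
  assume gt: "alg_gt (Var x) u"
  have "False" for a :: 'a
    using gt_wfp
  proof (induction a rule: wfp_induct_rule)
    case (less a)
    have "gt a (eval I (\<lambda>_. a) u)"
      using gt by (auto simp: alg_rel_def dest: spec[of _ "\<lambda>_. a"])
    then show ?case by (rule less)
  qed
  then show False .
qed

section \<open>The Boolean-indexed order: clauses, inversion and reflexivity\<close>

definition wpo :: "bool \<Rightarrow> ('f, 'v) trm \<Rightarrow> ('f, 'v) trm \<Rightarrow> bool" where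
  "wpo b = (if b then wpo_s F ar I ge gt prec \<sigma> else wpo_ns F ar I ge gt prec \<sigma>)"

lemma wpo_gt: "alg_gt (Fun f ss) t \<Longrightarrow> wpo b (Fun f ss) t"
  by (simp add: wpo_def ns_1 s_1)

lemma wpo_arg:
  "alg_ge (Fun f ss) t \<Longrightarrow> i \<in> set (\<sigma> f) \<Longrightarrow> wpo False (ss ! i) t \<Longrightarrow> wpo b (Fun f ss) t"
  by (auto simp: wpo_def intro: ns_2a s_2a)

lemma wpo_Fun:
  assumes "alg_ge (Fun f ss) (Fun g ts)" "\<And>j. j \<in> set (\<sigma> g) \<Longrightarrow> wpo True (Fun f ss) (ts ! j)"
    and "strict_part prec f g \<or> equiv_part prec f g \<and> lex_ext b wpo (args f ss) (args g ts)"
  shows "wpo b (Fun f ss) (Fun g ts)"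
  using assms by (auto simp: wpo_def lex_ext_def args_def intro!: ns_2b s_2b split: if_splits)

lemma wpo_Var_cases:
  assumes "wpo b (Var x) t"
  obtains "\<not> b" "t = Var x"
  | g ts where "\<not> b" "t = Fun g ts" "alg_ge (Var x) t" "\<sigma> g = []" "\<And>f. f \<in> F \<Longrightarrow> prec f g"
proof (cases b)
  case True
  with assms have "wpo_s F ar I ge gt prec \<sigma> (Var x) t" by (simp add: wpo_def)
  then show ?thesis by cases
next
  case False
  with assms have "wpo_ns F ar I ge gt prec \<sigma> (Var x) t" by (simp add: wpo_def)
  then show ?thesis by cases (use False that in auto)
qed

text \<open>The cases \<open>alg\<close>, \<open>arg\<close>, \<open>comp\<close> and
  \<open>max\<close> correspond to clauses 1, 2a, 2b and 2d; the last one occurs only in the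
  non-strict relation.\<close>

lemma wpo_Fun_cases:
  assumes "wpo b (Fun f ss) t"
  obtains (alg) "alg_gt (Fun f ss) t"
  | (arg) i where "alg_ge (Fun f ss) t" "i \<in> set (\<sigma> f)" "wpo False (ss ! i) t"
  | (comp) g ts where "t = Fun g ts" "alg_ge (Fun f ss) t"
      "\<And>j. j \<in> set (\<sigma> g) \<Longrightarrow> wpo True (Fun f ss) (ts ! j)"
      "strict_part prec f g \<or> equiv_part prec f g \<and> lex_ext b wpo (args f ss) (args g ts)"
  | (max) y where "\<not> b" "t = Var y" "simple_wrt F ar I \<sigma> gt" "alg_ge (Fun f ss) t"
      "\<And>g. g \<in> F \<Longrightarrow> strict_part prec f g \<or> prec f g \<and> \<sigma> g = []"
proof (cases b)
  case True
  with assms have "wpo_s F ar I ge gt prec \<sigma> (Fun f ss) t" by (simp add: wpo_def)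
  then show ?thesis
    by cases (use True alg arg comp in \<open>auto simp: wpo_def lex_ext_def args_def\<close>)
next
  case False
  with assms have "wpo_ns F ar I ge gt prec \<sigma> (Fun f ss) t" by (simp add: wpo_def)
  then show ?thesis
    by cases (use False alg arg comp max in \<open>auto simp: wpo_def lex_ext_def args_def\<close>)
qed

lemma wpo_Var_refl: "wpo False (Var x) (Var x)"
  by (simp add: wpo_def ns_var)

lemma wpo_Var_min:
  "alg_ge (Var x) (Fun g ts) \<Longrightarrow> \<sigma> g = [] \<Longrightarrow> (\<And>f. f \<in> F \<Longrightarrow> prec f g) \<Longrightarrow> wpo False (Var x) (Fun g ts)"
  by (simp add: wpo_def ns_2c)

lemma wpo_max_Var:
  "simple_wrt F ar I \<sigma> gt \<Longrightarrow> alg_ge (Fun f ss) (Var y) \<Longrightarrow>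
    (\<And>g. g \<in> F \<Longrightarrow> strict_part prec f g \<or> prec f g \<and> \<sigma> g = []) \<Longrightarrow> wpo False (Fun f ss) (Var y)"
  by (simp add: wpo_def ns_2d)

text \<open>Counterpart of clause \<open>ns_2c\<close> for a compound left-hand side: an empty
  status makes the argument conditions vacuous, and every list is weakly above the empty one. It is
  needed when a variable below which \<open>g\<close> lies is instantiated.\<close>

lemma wpo_Fun_min:
  assumes "alg_ge (Fun f ss) (Fun g ts)" "\<sigma> g = []" "prec f g"
  shows "wpo False (Fun f ss) (Fun g ts)"
  using assms lex_ext_Nil_right
  by (intro wpo_Fun) (auto simp: args_def strict_part_def equiv_part_def)

text \<open>Apart from reflexivity on variables and clause 1, every clause demands
  \<open>alg_ge\<close> outright; clause 1 yields it because \<open>gt\<close> is contained in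
  \<open>ge\<close>.\<close>

lemma wpo_imp_alg_ge: "wpo b s t \<Longrightarrow> alg_ge s t"
  by (cases s) (auto elim!: wpo_Var_cases wpo_Fun_cases intro: alg_ge_refl alg_gt_imp_ge)

lemma wpo_strict_imp: "wpo True s t \<Longrightarrow> wpo b s t"
proof (cases s)
  case (Fun f ss)
  assume "wpo True s t"
  then have "wpo True (Fun f ss) t" using Fun by simp
  then show ?thesis
  proof (cases rule: wpo_Fun_cases)
    case (comp g ts)
    then show ?thesis unfolding Fun
      by (metis wpo_Fun lex_ext_strict_imp)
  qed (auto simp: Fun intro: wpo_gt wpo_arg)
qed (auto elim: wpo_Var_cases)

text \<open>Weak simplicity and reflexivity of the arguments put each selected argument strictly
  below the term by clause 2a; clause 2b with equal roots then applies.\<close>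

lemma wpo_refl: "t \<in> terms F ar \<Longrightarrow> wpo False t t"
proof (induction rule: terms.induct)
  case (1 x)
  show ?case by (rule wpo_Var_refl)
next
  case (2 f ts)
  then have t: "Fun f ts \<in> terms F ar" by (auto simp: Fun_terms_iff)
  have refl: "wpo False (ts ! i) (ts ! i)" if "i \<in> set (\<sigma> f)" for i
    using 2 status_nth[OF t that] by blast
  show ?case
  proof (rule wpo_Fun)
    show "alg_ge (Fun f ts) (Fun f ts)" by (rule alg_ge_refl)
    show "wpo True (Fun f ts) (ts ! j)" if "j \<in> set (\<sigma> f)" for j
      by (rule wpo_arg[OF alg_rel_arg[OF simple t that] that refl[OF that]])
    have "lex_ext False wpo (args f ts) (args f ts)"
      by (rule lex_ext_pointwise) (auto simp: args_def refl)
    then show "strict_part prec f f \<or> equiv_part prec f f \<and> lex_ext False wpo (args f ts) (args f ts)"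
      using prec_refl 2 by (simp add: equiv_part_def)
  qed
qed

lemma wpo_subterm:
  assumes "Fun f ss \<in> terms F ar" "i \<in> set (\<sigma> f)"
  shows "wpo b (Fun f ss) (ss ! i)"
  using assms by (intro wpo_arg[of _ _ _ i] alg_rel_arg[OF simple] wpo_refl status_nth)

section \<open>Transitivity and compatibility\<close>

lemma precedence_trans:
  assumes "f \<in> F" "g \<in> F" "h \<in> F"
    and "strict_part prec f g \<or> equiv_part prec f g \<and> P"
    and "strict_part prec g h \<or> equiv_part prec g h \<and> Q"
  shows "strict_part prec f h \<or> equiv_part prec f h \<and> P \<and> Q"
  using assms prec_trans unfolding strict_part_def equiv_part_def by metis

text \<open>The index \<open>b \<or> c\<close> makes the composite strict as soon as one step is.
  The size sum drops in every recursive call, because one of \<open>s\<close>, \<open>t\<close>,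
  \<open>u\<close>, or all three of them, are replaced by arguments.\<close>

lemma wpo_trans:
  fixes s t u :: "('f, 'v) trm"
  assumes "s \<in> terms F ar" "t \<in> terms F ar" "u \<in> terms F ar" "wpo b s t" "wpo c t u"
  shows "wpo (b \<or> c) s u"
  using assms
proof (induction "size s + size t + size u" arbitrary: s t u b c rule: less_induct)
  case less
  note st = less.prems(4) and tu = less.prems(5)
  have ge: "alg_ge s u"
    using wpo_imp_alg_ge[OF st] wpo_imp_alg_ge[OF tu] by (rule alg_ge_trans)
  show ?case
  proof (cases s)
    case (Var x)
    from st[unfolded Var] show ?thesis
    proof (cases rule: wpo_Var_cases)
      case 1
      then show ?thesis using tu Var by simp
    next
      case (2 g ts)
      have g: "g \<in> F" using less.prems(2) 2 by (simp add: Fun_terms_iff)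
      from tu[unfolded 2(2)] show ?thesis
      proof (cases rule: wpo_Fun_cases)
        case alg
        then have "alg_gt (Var x) u" using alg_ge_gt_trans 2 by blast
        then show ?thesis by (simp add: not_Var_alg_gt)
      next
        case (arg i)
        then show ?thesis using 2 by simp
      next
        case (comp h us)
        have h: "h \<in> F" using less.prems(3) comp by (simp add: Fun_terms_iff)
        \<comment> \<open>As \<open>h\<close> is weakly above the least symbol \<open>g\<close>,
          clause 2b leaves only equivalent roots. Comparing from the empty list then forces
          \<open>c\<close> to be false and \<open>\<sigma> h\<close> to be empty, so
          \<open>h\<close> is least as well.\<close>
        have "\<not> strict_part prec g h" using 2(5)[OF h] by (simp add: strict_part_def)
        then have gh: "prec g h" "lex_ext c wpo [] (args h us)"
          using comp(4) 2(4) by (auto simp: equiv_part_def args_def)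
        then have "prec f h" if "f \<in> F" for f
          using prec_trans[OF that g h 2(5)[OF that]] by blast
        then show ?thesis
          using gh 2 Var comp ge by (auto simp: args_def intro: wpo_Var_min)
      next
        case (max y)
        have eq: "prec g h \<and> \<sigma> h = []" if "h \<in> F" for h
          using max(5)[OF that] 2(5)[OF that] by (auto simp: strict_part_def)
        have "x = y"
        proof (rule ccontr)
          assume "x \<noteq> y"
          \<comment> \<open>Distinct variables take values independently, so \<open>ge\<close>
            relates everything. Since \<open>g\<close> is both least and greatest, all symbols are
            equivalent with empty status, which \<open>nondegenerate\<close> excludes.\<close>
          have "ge a a'" for a a'
            using ge[unfolded Var max alg_rel_def, rule_format, of "\<lambda>z. if z = x then a else a'"]
              \<open>x \<noteq> y\<close> by simp
          moreover have "prec f h" if "f \<in> F" "h \<in> F" for f h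
            using prec_trans[OF that(1) g that(2)] 2(5) eq that by blast
          ultimately show False using nondegenerate eq g by blast
        qed
        then show ?thesis using wpo_Var_refl 2 Var max by simp
      qed
    qed
  next
    case (Fun f ss)
    have f: "f \<in> F" using less.prems(1) Fun by (simp add: Fun_terms_iff)
    from st[unfolded Fun] show ?thesis
    proof (cases rule: wpo_Fun_cases)
      case alg
      then show ?thesis
        using wpo_imp_alg_ge[OF tu] alg_gt_ge_trans wpo_gt Fun by blast
    next
      case (arg i)
      note si = status_nth[OF less.prems(1)[unfolded Fun] arg(2)]
      have "size (ss ! i) < size s" using size_list_estimation'[OF si(1) order_refl, of size] Fun by simp
      then have "wpo (False \<or> c) (ss ! i) u"
        by (intro less.hyps[of "ss ! i" t u]) (use arg less.prems si in auto)
      \<comment> \<open>Clause 2a asks only for the non-strict relation at the argument, even for a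
        strict conclusion.\<close>
      then have "wpo False (ss ! i) u" using wpo_strict_imp by (cases c) auto
      then show ?thesis using wpo_arg arg ge Fun by blast
    next
      case (max y)
      from tu[unfolded max] show ?thesis
      proof (cases rule: wpo_Var_cases)
        case 1
        then show ?thesis using st max by simp
      next
        case (2 g us)
        then have "prec f g"
          using max(5)[of g] less.prems(3) by (auto simp: strict_part_def Fun_terms_iff)
        then show ?thesis using wpo_Fun_min 2 max Fun ge by auto
      qed
    next
      case (comp g ts)
      have g: "g \<in> F" using less.prems(2) comp by (simp add: Fun_terms_iff)
      from tu[unfolded comp(1)] show ?thesis
      proof (cases rule: wpo_Fun_cases)
        case alg
        then show ?thesis using wpo_imp_alg_ge[OF st] alg_ge_gt_trans wpo_gt Fun comp by blast
      next
        case (arg j)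
        note tj = status_nth[OF less.prems(2)[unfolded comp(1)] arg(2)]
        have "size (ts ! j) < size t"
          using size_list_estimation'[OF tj(1) order_refl, of size] comp(1) by simp
        \<comment> \<open>Clause 2b puts \<open>s\<close> strictly above each selected argument of
          \<open>t\<close>, so the composite is strict whatever \<open>b\<close> and
          \<open>c\<close> are.\<close>
        then have "wpo (True \<or> False) s u"
          by (intro less.hyps[of s "ts ! j" u])
            (use less.prems tj comp(3)[OF arg(2)] arg(3) Fun in auto)
        then show ?thesis using wpo_strict_imp by simp
      next
        case inner: (comp h us)
        have h: "h \<in> F" using less.prems(3) inner by (simp add: Fun_terms_iff)
        have u_args: "wpo True s (us ! k)" if k: "k \<in> set (\<sigma> h)" for k
        proof -
          note uk = status_nth[OF less.prems(3)[unfolded inner(1)] k]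
          have "size (us ! k) < size u"
            using size_list_estimation'[OF uk(1) order_refl, of size] inner(1) by simp
          then have "wpo (b \<or> True) s (us ! k)"
            by (intro less.hyps[of s t "us ! k"])
              (use less.prems uk inner(3)[OF k] comp(1) in auto)
          then show ?thesis by simp
        qed
        have lex: "lex_ext (b \<or> c) wpo (args f ss) (args h us)"
          if "lex_ext b wpo (args f ss) (args g ts)" "lex_ext c wpo (args g ts) (args h us)"
        proof (rule lex_ext_trans[OF _ that])
          fix x y z :: "('f, 'v) trm" and b c
          assume "x \<in> set (args f ss)" "y \<in> set (args g ts)" "z \<in> set (args h us)"
            and xyz: "wpo b x y" "wpo c y z"
          then have mem: "x \<in> set ss" "y \<in> set ts" "z \<in> set us"
            using args_subset less.prems(1-3) unfolding Fun comp(1) inner(1) by blast+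
          have "size x < size s" "size y < size t" "size z < size u"
            using mem[THEN size_list_estimation'[OF _ order_refl, of _ _ size]]
            unfolding Fun comp(1) inner(1) by simp_all
          then show "wpo (b \<or> c) x z"
            by (intro less.hyps[of x y z])
              (use less.prems(1-3) mem xyz in \<open>auto simp: Fun comp(1) inner(1) Fun_terms_iff\<close>)
        qed
        \<comment> \<open>The roots \<open>f\<close> and \<open>h\<close> can be equivalent only if
          both steps are equivalences, and then both lexicographic comparisons are at hand.\<close>
        show ?thesis
          unfolding Fun inner(1)
          using ge u_args precedence_trans[OF f g h comp(4) inner(4)] lex
          by (intro wpo_Fun) (auto simp: Fun inner(1))
      next
        case (max y)
        \<comment> \<open>Maximality passes from \<open>g\<close> to \<open>f\<close> and, applied
          to \<open>f\<close> itself, forces \<open>\<sigma> f\<close> to be empty. The roots are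
          equivalent and the empty list is strictly above nothing, so \<open>b\<close> is false and
          clause \<open>ns_2d\<close> suffices.\<close>
        have fg: "prec f g" using comp(4) by (auto simp: strict_part_def equiv_part_def)
        have maximal: "strict_part prec f h \<or> prec f h \<and> \<sigma> h = []" if "h \<in> F" for h
          using max(5)[OF that] fg prec_trans[OF f g that] prec_trans[OF that f g]
          by (auto simp: strict_part_def)
        have "\<not> strict_part prec f f" by (simp add: strict_part_def)
        then have "\<sigma> f = []" using maximal[OF f] by blast
        moreover have "\<not> strict_part prec f g"
          using max(5)[OF f] by (auto simp: strict_part_def)
        ultimately have "\<not> b" using comp(4) by (auto simp: args_def)
        then show ?thesis using max maximal ge Fun by (auto intro: wpo_max_Var)
      qed
    qed
  qed
qed

section \<open>Monotonicity and stability\<close>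

lemma wpo_monotonic:
  assumes f: "f \<in> F" and len: "length ss = ar f" and ss: "set ss \<subseteq> terms F ar" and i: "i < ar f"
    and t: "t \<in> terms F ar" and st: "wpo False (ss ! i) t"
  shows "wpo False (Fun f ss) (Fun f (ss[i := t]))"
proof (rule wpo_Fun)
  have s: "Fun f ss \<in> terms F ar" using f len ss by (simp add: Fun_terms_iff)
  have args: "wpo False (ss ! j) (ss[i := t] ! j)" if "j \<in> set (\<sigma> f)" for j
    using st status_nth[OF s that] wpo_refl i len by (cases "i = j") auto
  have "ge (I f (map (eval I \<alpha>) ss)) (I f ((map (eval I \<alpha>) ss)[i := eval I \<alpha> t]))" for \<alpha>
    using monotone f len i wpo_imp_alg_ge[OF st] by (auto simp: weakly_monotone_def alg_rel_def)
  then show "alg_ge (Fun f ss) (Fun f (ss[i := t]))"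
    by (simp add: alg_rel_def map_update)
  \<comment> \<open>The old term is strictly above its old argument, which is weakly above the new
    one; \<open>wpo_trans\<close> composes the two.\<close>
  show "wpo True (Fun f ss) (ss[i := t] ! j)" if j: "j \<in> set (\<sigma> f)" for j
  proof -
    have "ss[i := t] ! j \<in> terms F ar"
      using status_nth[OF s j] t i len by (cases "i = j") auto
    then show ?thesis
      using wpo_trans[OF s status_nth(2)[OF s j] _ wpo_subterm[OF s j, of True] args[OF j]] by simp
  qed
  have "lex_ext False wpo (args f ss) (args f (ss[i := t]))"
    by (rule lex_ext_pointwise) (auto simp: args_def args)
  then show "strict_part prec f f \<or>
      equiv_part prec f f \<and> lex_ext False wpo (args f ss) (args f (ss[i := t]))"
    using prec_refl[OF f] by (simp add: equiv_part_def)
qed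

lemma args_map:
  assumes "Fun f ss \<in> terms F ar"
  shows "args f (map h ss) = map h (args f ss)"
  using assms status_less[of f] by (auto simp: args_def Fun_terms_iff)

text \<open>Clauses 1, 2a and 2b carry over to the instance by induction on size. The new work
  arises when a variable becomes a compound term: clauses \<open>ns_2c\<close> and
  \<open>ns_2d\<close> then turn into clause 2b.\<close>

lemma wpo_stable:
  fixes s t :: "('f, 'v) trm"
  assumes "range \<theta> \<subseteq> terms F ar" "s \<in> terms F ar" "t \<in> terms F ar" "wpo b s t"
  shows "wpo b (subst \<theta> s) (subst \<theta> t)"
  using assms(2-)
proof (induction "size s + size t" arbitrary: s t b rule: less_induct)
  case less
  note st = less.prems(3)
  have ge: "alg_ge (subst \<theta> s) (subst \<theta> t)"
    by (rule alg_rel_subst[OF wpo_imp_alg_ge[OF st]])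
  have range: "\<theta> x \<in> terms F ar" for x using assms(1) by auto
  show ?case
  proof (cases s)
    case (Var x)
    from st[unfolded Var] show ?thesis
    proof (cases rule: wpo_Var_cases)
      case 1
      then show ?thesis using wpo_refl[OF range] Var by simp
    next
      case (2 g ts)
      show ?thesis
      proof (cases "\<theta> x")
        case (Var z)
        then show ?thesis using 2 ge \<open>s = Var x\<close> by (auto intro: wpo_Var_min)
      next
        case (Fun f us)
        then have "f \<in> F" using range[of x] by (simp add: Fun_terms_iff)
        then show ?thesis using 2 ge Fun \<open>s = Var x\<close> by (auto intro: wpo_Fun_min)
      qed
    qed
  next
    case (Fun f ss)
    from st[unfolded Fun] show ?thesis
    proof (cases rule: wpo_Fun_cases)
      case alg
      then show ?thesis using alg_rel_subst[OF alg, of \<theta>] wpo_gt Fun by simp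
    next
      case (arg i)
      note si = status_nth[OF less.prems(1)[unfolded Fun] arg(2)]
      have "size (ss ! i) < size s" using size_list_estimation'[OF si(1) order_refl, of size] Fun by simp
      then have "wpo False (subst \<theta> (ss ! i)) (subst \<theta> t)"
        by (intro less.hyps) (use arg less.prems si in auto)
      moreover have "i < length ss"
        using status_less[of f i] less.prems(1) arg(2) by (simp add: Fun Fun_terms_iff)
      ultimately show ?thesis using wpo_arg[of f "map (subst \<theta>) ss" _ i] arg ge Fun by simp
    next
      case (comp g ts)
      have t_args: "wpo True (subst \<theta> s) (map (subst \<theta>) ts ! j)" if j: "j \<in> set (\<sigma> g)" for j
      proof -
        note tj = status_nth[OF less.prems(2)[unfolded comp(1)] j]
        have "size (ts ! j) < size t"
          using size_list_estimation'[OF tj(1) order_refl, of size] comp(1) by simp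
        then have "wpo True (subst \<theta> s) (subst \<theta> (ts ! j))"
          by (intro less.hyps) (use less.prems tj comp(3)[OF j] Fun in auto)
        then show ?thesis
          using status_less[of g j] less.prems(2) j by (simp add: comp(1) Fun_terms_iff)
      qed
      have lex: "lex_ext b wpo (args f (map (subst \<theta>) ss)) (args g (map (subst \<theta>) ts))"
        if "lex_ext b wpo (args f ss) (args g ts)"
        unfolding args_map[OF less.prems(1)[unfolded Fun]] args_map[OF less.prems(2)[unfolded comp(1)]]
      proof (rule lex_ext_map[OF that])
        fix c and x y :: "('f, 'v) trm"
        assume "x \<in> set (args f ss)" "y \<in> set (args g ts)" and xy: "wpo c x y"
        then have mem: "x \<in> set ss" "y \<in> set ts"
          using args_subset less.prems(1,2) unfolding Fun comp(1) by blast+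
        have "size x < size s" "size y < size t"
          using mem[THEN size_list_estimation'[OF _ order_refl, of _ _ size]]
          unfolding Fun comp(1) by simp_all
        then show "wpo c (subst \<theta> x) (subst \<theta> y)"
          by (intro less.hyps)
            (use less.prems(1,2) mem xy in \<open>auto simp: Fun comp(1) Fun_terms_iff\<close>)
      qed
      show ?thesis
        using ge t_args comp(4) lex unfolding Fun comp(1) subst.simps by (intro wpo_Fun) auto
    next
      case (max y)
      show ?thesis
      proof (cases "\<theta> y")
        case (Var z)
        then show ?thesis using max ge Fun by (auto intro: wpo_max_Var)
      next
        case u: (Fun g us)
        have g: "Fun g us \<in> terms F ar" "g \<in> F" using range[of y] u by (simp_all add: Fun_terms_iff)
        have ge': "alg_ge (Fun f (map (subst \<theta>) ss)) (Fun g us)" using ge u max(2) Fun by simp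
        have "wpo False (Fun f (map (subst \<theta>) ss)) (Fun g us)"
          using max(5)[OF g(2)]
        proof
          assume "strict_part prec f g"
          \<comment> \<open>Strict simplicity sharpens \<open>ge'\<close> to \<open>alg_gt\<close>
            at every selected argument, so clause 1 supplies the strict comparisons that clause 2b
            requires.\<close>
          moreover have "wpo True (Fun f (map (subst \<theta>) ss)) (us ! j)" if "j \<in> set (\<sigma> g)" for j
            by (rule wpo_gt[OF alg_ge_gt_trans[OF ge' alg_rel_arg[OF max(3) g(1) that]]])
          ultimately show ?thesis using ge' by (intro wpo_Fun) auto
        next
          assume "prec f g \<and> \<sigma> g = []"
          then show ?thesis using ge' by (intro wpo_Fun_min) auto
        qed
        then show ?thesis using max(1,2) u Fun by simp
      qed
    qed
  qed
qed

section \<open>Well-foundedness\<close>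

lemma wpo_wfp: "wfp_on (terms F ar) (\<lambda>t s. wpo True s (t :: ('f, 'v) trm))"
proof -
  let ?T = "terms F ar :: ('f, 'v) trm set"
  define r where "r = (\<lambda>t s. wpo True s t \<and> t \<in> ?T \<and> s \<in> ?T)"
  define A where "A = {s \<in> ?T. Wellfounded.accp r s}"
  \<comment> \<open>Finiteness of \<open>F\<close> makes the maximum exist; inserting 0 covers an
    empty signature.\<close>
  define N where "N = Max (insert 0 ((\<lambda>f. length (\<sigma> f)) ` F))"
  \<comment> \<open>\<open>alg_rel\<close> quantifies over all assignments, so any fixed one maps
    descents of terms to descents in the carrier.\<close>
  define val where "val = eval I (\<lambda>_ :: 'v. undefined)"
  have val_ge: "ge (val s) (val t)" if "alg_ge s t" for s t
    using that by (simp add: alg_rel_def val_def)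
  have val_gt: "gt (val s) (val t)" if "alg_gt s t" for s t
    using that by (simp add: alg_rel_def val_def)
  have length_args: "length (args f ss) \<le> N" if "f \<in> F" for f and ss :: "('f, 'v) trm list"
    using that finite_F by (auto simp: N_def args_def intro!: Max_ge)
  have Var_acc: "Wellfounded.accp r (Var x)" for x
    by (rule accpI) (auto simp: r_def elim: wpo_Var_cases)
  \<comment> \<open>\<open>A\<close> contains only accessible terms, so the order is already known
    to be well-founded there; this avoids circularity in the lexicographic induction.\<close>
  have "wfp_on A (\<lambda>t s. wpo True s t)"
  proof (subst wfp_on_iff_wfp, rule accp_wfpI, rule allI, rule accpI)
    fix s t assume "wpo True s t \<and> t \<in> A \<and> s \<in> A"
    then have "Wellfounded.accp r t" by (simp add: A_def)
    then show "Wellfounded.accp (\<lambda>x y. wpo True y x \<and> x \<in> A \<and> y \<in> A) t"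
      by (rule accp_subset[THEN predicate1D, rotated]) (auto simp: r_def A_def)
  qed
  then have lex_wfp: "wfp_on {xs. set xs \<subseteq> A \<and> length xs \<le> N} (\<lambda>xs ys. lex_ext True wpo ys xs)"
    by (rule wfp_on_lex_ext) (auto simp: A_def intro: wpo_refl wpo_trans)
  \<comment> \<open>The bounds \<open>ge a (val ...)\<close> and, further inside,
    \<open>prec f g\<close> replace equalities, since a step that decreases a later component may
    move an earlier one weakly down.\<close>
  have Fun_acc: "\<forall>f ss. Fun f ss \<in> ?T \<longrightarrow> ge a (val (Fun f ss)) \<longrightarrow> set (args f ss) \<subseteq> A \<longrightarrow>
      Wellfounded.accp r (Fun f ss)" for a
    using gt_wfp
  proof (induction a rule: wfp_induct_rule)
    case val_IH: (less a)
    have "\<forall>g ss. prec f g \<longrightarrow> Fun g ss \<in> ?T \<longrightarrow> ge a (val (Fun g ss)) \<longrightarrow> set (args g ss) \<subseteq> A \<longrightarrow>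
      Wellfounded.accp r (Fun g ss)" if "f \<in> F" for f
      using prec_wfp
    proof (induction f rule: wfp_on_induct)
      case in_set
      show ?case by (fact that)
    next
      case prec_IH: (less f)
      have list_acc: "\<forall>g ss. prec f g \<longrightarrow> Fun g ss \<in> ?T \<longrightarrow> ge a (val (Fun g ss)) \<longrightarrow> args g ss = xs \<longrightarrow>
        Wellfounded.accp r (Fun g ss)" if "xs \<in> {xs. set xs \<subseteq> A \<and> length xs \<le> N}" for xs
        using lex_wfp
      proof (induction xs rule: wfp_on_induct)
        case in_set
        show ?case by (fact that)
      next
        case lex_IH: (less xs)
        show ?case
        proof (intro allI impI)
          fix g ss
          assume fg: "prec f g" and s: "Fun g ss \<in> ?T" and a: "ge a (val (Fun g ss))"
            and xs: "args g ss = xs"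
          have g: "g \<in> F" using s by (simp add: Fun_terms_iff)
          \<comment> \<open>Structural induction on the term below: by transitivity its selected
            arguments are also strictly below \<open>Fun g ss\<close>, hence accessible. So
            \<open>t\<close> itself meets the condition on \<open>args\<close> in the outer
            induction hypotheses.\<close>
          have "t \<in> ?T \<Longrightarrow> wpo True (Fun g ss) t \<Longrightarrow> Wellfounded.accp r t" for t
          proof (induction t)
            case (Var x)
            show ?case by (rule Var_acc)
          next
            case t: (Fun h ts)
            have h: "h \<in> F" using t.prems(1) by (simp add: Fun_terms_iff)
            have ts: "set (args h ts) \<subseteq> A"
            proof
              fix u assume "u \<in> set (args h ts)"
              then obtain j where j: "j \<in> set (\<sigma> h)" "u = ts ! j" by (auto simp: args_def)
              note u = status_nth[OF t.prems(1) j(1)]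
              have "wpo (True \<or> False) (Fun g ss) u"
                using wpo_trans[OF s t.prems(1) u(2) t.prems(2) wpo_subterm[OF t.prems(1) j(1)]] j
                by simp
              then show "u \<in> A" using t.IH u j by (simp add: A_def)
            qed
            have a': "ge a (val (Fun h ts))"
              using a val_ge[OF wpo_imp_alg_ge[OF t.prems(2)]] by (rule ge_trans)
            from t.prems(2) show ?case
            proof (cases rule: wpo_Fun_cases)
              case alg
              have "gt a (val (Fun h ts))"
                using gt_compat[OF a val_gt[OF alg] ge_refl] .
              then show ?thesis using val_IH ge_refl t.prems(1) ts by blast
            next
              case (arg i)
              \<comment> \<open>Here \<open>Fun h ts\<close> is weakly below the accessible term
                \<open>ss ! i\<close>, so all its \<open>r\<close>-predecessors are
                \<open>r\<close>-predecessors of \<open>ss ! i\<close>.\<close>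
              have "ss ! i \<in> A" using lex_IH.hyps xs arg(2) by (auto simp: args_def)
              then have i: "ss ! i \<in> ?T" "Wellfounded.accp r (ss ! i)" by (auto simp: A_def)
              show ?thesis
              proof (rule accpI)
                fix u assume "r u (Fun h ts)"
                then have "r u (ss ! i)"
                  using wpo_trans[OF i(1) t.prems(1) _ arg(3), of u True] i(1) by (simp add: r_def)
                with i(2) show "Wellfounded.accp r u" by (rule accp_downward)
              qed
            next
              case (comp h' ts')
              then have gh: "strict_part prec g h \<or> equiv_part prec g h \<and>
                  lex_ext True wpo (args g ss) (args h ts)" by simp
              then have fh: "prec f h"
                using prec_trans[OF prec_IH.hyps g h fg] by (auto simp: strict_part_def equiv_part_def)
              from gh show ?thesis
              proof
                assume "strict_part prec g h"
                then have "strict_part prec f h"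
                  using fh fg prec_trans[OF h prec_IH.hyps g] by (auto simp: strict_part_def)
                then show ?thesis using prec_IH.IH[OF h] prec_refl[OF h] t.prems(1) a' ts by blast
              next
                assume "equiv_part prec g h \<and> lex_ext True wpo (args g ss) (args h ts)"
                then show ?thesis
                  using lex_IH.IH[of "args h ts"] fh t.prems(1) a' ts length_args[OF h] xs by blast
              qed
            qed simp
          qed
          then show "Wellfounded.accp r (Fun g ss)"
            by - (rule accpI, simp add: r_def)
        qed
      qed
      show ?case
      proof (intro allI impI)
        fix g ss
        assume s: "prec f g" "Fun g ss \<in> ?T" "ge a (val (Fun g ss))" "set (args g ss) \<subseteq> A"
        then have "args g ss \<in> {xs. set xs \<subseteq> A \<and> length xs \<le> N}"
          using length_args by (simp add: Fun_terms_iff)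
        from list_acc[OF this] s(1-3) show "Wellfounded.accp r (Fun g ss)" by simp
      qed
    qed
    then show ?case using prec_refl by (metis Fun_terms_iff)
  qed
  have "Wellfounded.accp r t" if "t \<in> ?T" for t
    using that
  proof (induction rule: terms.induct)
    case (1 x)
    show ?case by (rule Var_acc)
  next
    case (2 f ts)
    then have t: "Fun f ts \<in> ?T" by (auto simp: Fun_terms_iff)
    moreover have "set (args f ts) \<subseteq> A"
      using args_subset[OF t] 2 by (auto simp: A_def)
    ultimately show ?case using Fun_acc ge_refl by blast
  qed
  moreover have "Wellfounded.accp r t" if "t \<notin> ?T" for t
    using that by - (rule accpI, simp add: r_def)
  ultimately have "wfp r" by (auto intro: accp_wfpI)
  then show ?thesis unfolding r_def by (subst wfp_on_iff_wfp)
qed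

section \<open>Assembling the reduction pair\<close>

lemma wpo_reduction_pair:
  "trm_reduction_pair F ar (wpo False :: ('f, 'v) trm \<Rightarrow> _) (wpo True)"
proof -
  let ?T = "terms F ar :: ('f, 'v) trm set"
  \<comment> \<open>Irreflexivity comes from well-foundedness: a loop at \<open>s\<close> would let
    the induction hypothesis apply to \<open>s\<close> itself.\<close>
  have "\<not> wpo True s s" if "s \<in> ?T" for s
    using wpo_wfp
  proof (induction s rule: wfp_on_induct)
    case in_set
    show ?case by (fact that)
  next
    case (less s)
    then show ?case by blast
  qed
  moreover have "transp_on ?T (wpo b)" for b
    using wpo_trans[of _ _ _ b b] by (auto intro!: transp_onI)
  moreover have "wpo True s v"
    if "s \<in> ?T" "t \<in> ?T" "u \<in> ?T" "v \<in> ?T" "wpo False s t" "wpo True t u" "wpo False u v" for s t u v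
    using wpo_trans[of s t u False True] wpo_trans[of s u v True False] that by simp
  ultimately have "wf_order_pair_on ?T (wpo False) (wpo True)"
    using wpo_wfp wpo_refl
    unfolding wf_order_pair_on_def quasi_order_on_def strict_ord_on_def well_founded_on_def
      compatible_on_def reflp_on_def irreflp_on_def conversep_iff[abs_def] by blast
  moreover have "monotonic F ar (wpo False :: ('f, 'v) trm \<Rightarrow> _)"
    unfolding monotonic_def by (intro ballI allI impI) (rule wpo_monotonic)
  moreover have "stable F ar (wpo b :: ('f, 'v) trm \<Rightarrow> _)" for b
    unfolding stable_def by (intro ballI allI impI) (rule wpo_stable)
  ultimately show ?thesis by (simp add: trm_reduction_pair_def)
qed

end

theorem theorem22:
  fixes F :: "'f set" and ar :: "'f \<Rightarrow> nat"
    and I :: "'f \<Rightarrow> 'a list \<Rightarrow> 'a"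
    and ge gt :: "'a \<Rightarrow> 'a \<Rightarrow> bool"
    and prec :: "'f \<Rightarrow> 'f \<Rightarrow> bool" and \<sigma> :: "'f \<Rightarrow> nat list"
  assumes "finite F"
    and "well_founded_algebra ge gt"
    and gt_imp_ge: "\<And>a b. gt a b \<Longrightarrow> ge a b"
    and "quasi_precedence F prec"
    and "partial_status F ar \<sigma>"
    and nondegenerate: "\<not> (F \<noteq> {} \<and> (\<forall>a b. ge a b) \<and> (\<forall>f\<in>F. \<sigma> f = []) \<and> (\<forall>f\<in>F. \<forall>g\<in>F. prec f g))"
    and "weakly_monotone F ar I ge"
    and "simple_wrt F ar I \<sigma> ge"
  shows "trm_reduction_pair F ar
    (wpo_ns F ar I ge gt prec \<sigma> :: ('f, 'v) trm \<Rightarrow> ('f, 'v) trm \<Rightarrow> bool)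
    (wpo_s F ar I ge gt prec \<sigma>)"
proof -
  interpret wpo_setting F ar I ge gt prec \<sigma>
    by unfold_locales (use assms in blast)+
  show ?thesis using wpo_reduction_pair unfolding wpo_def if_True if_False .
qed

end
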